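(* For every query $Q$, the output of the max-degree algorithm on input $Q$ and the output of the max-degree-with-redundancy algorithm on input $Q$ (for any choice of ties) are both decompositions of $Q$ that include only subject-object star queries.
   Context: Fix countably infinite, pairwise disjoint sets $U_{so}$ and $U_p$ (URIs), $L$ (literals) and $\mathrm{Var}$ (variables). A query is a finite non-empty set of triples in $(U_{so}\cup \mathrm{Var})\times U_p\times (U_{so}\cup L\cup \mathrm{Var})$. In a triple $(s,p,o)$, $s$ is the subject and $o$ the object; $\mathcal{N}(Q)$ is the set of all subjects and objects of triples of $Q$. A decomposition of $Q$ is a finite family of non-empty subsets (subqueries) of $Q$ whose union is $Q$. A subject-object star query (so-query) is a query for which there is a node $c$ (central node) such that every triple has $c$ as subject or object and at least one triple has $c$ as subject. The max-degree algorithm on input $Q$. Initialize $R=\emptyset$, $T=\emptyset$ (covered triples), and let $S_Q$ be the set of all pairs $(n,S(n))$ where $n\in\mathcal{N}(Q)\setminus L$ is the subject of at least one triple of $Q$ and $S(n)$ is the set of all triples of $Q$ having $n$ as subject or object. While $S_Q\ne\emptyset$: select a pair $(n,Q')\in S_Q$ with $|Q'|$ maximal among all pairs in $S_Q$ (ties broken arbitrarily); add $Q'$ to $R$; replace $T$ by $T\cup Q'$; delete $(n,Q')$ from $S_Q$; then replace each remaining pair $(m,S)$ of $S_Q$ by $(m,S\setminus T)$ if $S\setminus T$ contains a triple with subject $m$, and delete the pair otherwise. Return $R$. The max-degree-with-redundancy algorithm is identical, except that at each iteration, instead of adding $Q'$ to $R$, it adds to $R$ the set $Q''=Q'\cup\{(n_1,p,n_2)\in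 Q\setminus Q' \mid (n_1=n \text{ and } n_2 \text{ is not a variable}) \text{ or } (n_2=n\text{ and } n_1\text{ is not a variable})\}$, where $n$ is the node of the selected pair (the set $T$ is still updated with $Q'$ only). *)

theory Defs
  imports Complex_Main "HOL-Library.Countable_Set" "HOL-Library.While_Combinator"
begin

type_synonym 'a triple = "'a \<times> 'a \<times> 'a"

definition vocabulary :: "'a set \<Rightarrow> 'a set \<Rightarrow> 'a set \<Rightarrow> 'a set \<Rightarrow> bool" where
  "vocabulary Uso Up L Var \<longleftrightarrow>
     (\<forall>A \<in> {Uso, Up, L, Var}. countable A \<and> infinite A) \<and>
     Uso \<inter> Up = {} \<and> Uso \<inter> L = {} \<and> Uso \<inter> Var = {} \<and>
     Up \<inter> L = {} \<and> Up \<inter> Var = {} \<and> L \<inter> Var = {}"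

definition is_query :: "'a set \<Rightarrow> 'a set \<Rightarrow> 'a set \<Rightarrow> 'a set \<Rightarrow> 'a triple set \<Rightarrow> bool" where
  "is_query Uso Up L Var Q \<longleftrightarrow>
     finite Q \<and> Q \<noteq> {} \<and> Q \<subseteq> (Uso \<union> Var) \<times> Up \<times> (Uso \<union> L \<union> Var)"

definition subjects :: "'a triple set \<Rightarrow> 'a set" where
  "subjects Q = {s. \<exists>p ob. (s, p, ob) \<in> Q}"

definition objects :: "'a triple set \<Rightarrow> 'a set" where
  "objects Q = {ob. \<exists>s p. (s, p, ob) \<in> Q}"

definition nodes :: "'a triple set \<Rightarrow> 'a set" where
  "nodes Q = subjects Q \<union> objects Q"

definition is_decomposition :: "'a triple set \<Rightarrow> 'a triple set set \<Rightarrow> bool" where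
  "is_decomposition Q R \<longleftrightarrow> finite R \<and> (\<forall>Q' \<in> R. Q' \<noteq> {} \<and> Q' \<subseteq> Q) \<and> \<Union>R = Q"

definition is_so_query :: "'a set \<Rightarrow> 'a set \<Rightarrow> 'a set \<Rightarrow> 'a set \<Rightarrow> 'a triple set \<Rightarrow> bool" where
  "is_so_query Uso Up L Var Q \<longleftrightarrow>
     is_query Uso Up L Var Q \<and>
     (\<exists>c \<in> nodes Q. (\<forall>(s, p, ob) \<in> Q. s = c \<or> ob = c) \<and> c \<in> subjects Q)"

definition star :: "'a triple set \<Rightarrow> 'a \<Rightarrow> 'a triple set" where
  "star Q n = {(s, p, ob) \<in> Q. s = n \<or> ob = n}"

text \<open>A state \<open>(R, T, S)\<close> consists of the subqueries output so far, the triples covered so far,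
  and the set of candidate pairs.\<close>

type_synonym 'a state = "'a triple set set \<times> 'a triple set \<times> ('a \<times> 'a triple set) set"

definition initial_state :: "'a set \<Rightarrow> 'a triple set \<Rightarrow> 'a state" where
  "initial_state L Q = ({}, {}, {(n, star Q n) | n. n \<in> nodes Q - L \<and> n \<in> subjects Q})"

text \<open>A selection rule resolves the ties: it picks a pair of maximal cardinality. It may depend on
  the whole state; as the number of candidate pairs decreases in each iteration, no state
  recurs during a run, so every sequence of tie-breaking choices is given by some selection rule.
  The finiteness guard only excludes sets of pairs that never arise for a (finite) query and that
  need not have a maximal pair.\<close>

definition selection_rule :: "('a state \<Rightarrow> 'a \<times> 'a triple set) \<Rightarrow> bool" where
  "selection_rule sel \<longleftrightarrow>
     (\<forall>R T S. finite S \<and> S \<noteq> {} \<longrightarrow> is_arg_max (\<lambda>(n, Q'). card Q') (\<lambda>x. x \<in> S) (sel (R, T, S)))"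

lemma selection_rule_exists: "\<exists>sel :: 'a state \<Rightarrow> 'a \<times> 'a triple set. selection_rule sel"
proof -
  have "\<exists>x. is_arg_max f (\<lambda>x. x \<in> S) x" if "finite S" "S \<noteq> {}"
    for S :: "('a \<times> 'a triple set) set" and f :: "'a \<times> 'a triple set \<Rightarrow> nat"
  proof -
    have "Max (f ` S) \<in> f ` S"
      using that by (intro Max_in) simp_all
    then obtain x where x: "Max (f ` S) = f x" "x \<in> S"
      by (rule imageE)
    have "is_arg_max f (\<lambda>x. x \<in> S) x"
      unfolding is_arg_max_linorder using x Max_ge[of "f ` S"] \<open>finite S\<close> by simp
    then show ?thesis ..
  qed
  then have "\<forall>S. finite S \<and> S \<noteq> {} \<longrightarrow>
      (\<exists>x. is_arg_max (\<lambda>(n, Q'). card Q') (\<lambda>x. x \<in> S) (x :: 'a \<times> 'a triple set))"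
    by simp
  then obtain g where "\<forall>S. finite S \<and> S \<noteq> {} \<longrightarrow>
      is_arg_max (\<lambda>(n, Q'). card Q') (\<lambda>x. x \<in> S) (g S :: 'a \<times> 'a triple set)"
    unfolding choice_iff' ..
  then have "selection_rule (\<lambda>(R, T, S). g S)"
    unfolding selection_rule_def prod.case by (intro allI) (erule spec)
  then show ?thesis by (intro exI)
qed

text \<open>The two algorithms differ only in the set \<open>ext n Q'\<close> that is added to the output when the
  pair \<open>(n, Q')\<close> is selected.\<close>

definition iteration ::
  "('a state \<Rightarrow> 'a \<times> 'a triple set) \<Rightarrow> ('a \<Rightarrow> 'a triple set \<Rightarrow> 'a triple set) \<Rightarrow> 'a state \<Rightarrow> 'a state"
  where
  "iteration sel ext = (\<lambda>(R, T, S).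
     let (n, Q') = sel (R, T, S);
         T' = T \<union> Q'
     in (insert (ext n Q') R,
         T',
         {(m, S\<^sub>m - T') | m S\<^sub>m. (m, S\<^sub>m) \<in> S - {(n, Q')} \<and> m \<in> subjects (S\<^sub>m - T')}))"

text \<open>The value is \<open>None\<close> iff the loop does not terminate.\<close>

definition run ::
  "('a state \<Rightarrow> 'a \<times> 'a triple set) \<Rightarrow> ('a \<Rightarrow> 'a triple set \<Rightarrow> 'a triple set) \<Rightarrow>
   'a set \<Rightarrow> 'a triple set \<Rightarrow> 'a triple set set option" where
  "run sel ext L Q =
     map_option (\<lambda>(R, T, S). R)
       (while_option (\<lambda>(R, T, S). S \<noteq> {}) (iteration sel ext) (initial_state L Q))"

definition max_degree ::
  "('a state \<Rightarrow> 'a \<times> 'a triple set) \<Rightarrow> 'a set \<Rightarrow> 'a triple set \<Rightarrow> 'a triple set set option" where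
  "max_degree sel L Q = run sel (\<lambda>n Q'. Q') L Q"

definition redundant_extension ::
  "'a set \<Rightarrow> 'a triple set \<Rightarrow> 'a \<Rightarrow> 'a triple set \<Rightarrow> 'a triple set" where
  "redundant_extension Var Q n Q' =
     Q' \<union> {(n1, p, n2) \<in> Q - Q'. (n1 = n \<and> n2 \<notin> Var) \<or> (n2 = n \<and> n1 \<notin> Var)}"

definition max_degree_with_redundancy ::
  "('a state \<Rightarrow> 'a \<times> 'a triple set) \<Rightarrow> 'a set \<Rightarrow> 'a set \<Rightarrow> 'a triple set \<Rightarrow> 'a triple set set option"
  where
  "max_degree_with_redundancy sel L Var Q = run sel (redundant_extension Var Q) L Q"

end

theory Submission
  imports Defs
begin

text \<open>While the loop runs, the set of candidate pairs is determined by the set \<open>T\<close> of covered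
  triples: it consists of the pairs \<open>(n, star Q n - T)\<close> where \<open>n\<close> is the subject of an uncovered
  triple. Hence each iteration covers a new triple, and no candidate is left only when all of
  \<open>Q\<close> is covered. For such \<open>n\<close>, every set between \<open>star Q n - T\<close> and \<open>star Q n\<close> is a star query with centre \<open>n\<close>,
  and both algorithms add a set of this kind to the output.\<close>

definition candidates :: "'a triple set \<Rightarrow> 'a triple set \<Rightarrow> ('a \<times> 'a triple set) set" where
  "candidates Q T = (\<lambda>n. (n, star Q n - T)) ` subjects (Q - T)"

lemma finite_subjects: "finite Q \<Longrightarrow> finite (subjects Q)"
  by (rule finite_subset[of _ "fst ` Q"]) (force simp: subjects_def)+

text \<open>All triples of \<open>Q\<close> with subject \<open>n\<close> lie in
  \<open>star Q n\<close>. This turns the test that the algorithm applies to a pair into a condition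
  on the uncovered triples alone.\<close>

lemma subjects_star_Diff: "n \<in> subjects (star Q n - T) \<longleftrightarrow> n \<in> subjects (Q - T)"
  by (auto simp: subjects_def star_def)

lemma not_subject_if_star_covered: "n \<notin> subjects (Q - (T \<union> (star Q n - T)))"
  by (auto simp: subjects_def star_def)

lemma candidates_eq_empty_iff: "candidates Q T = {} \<longleftrightarrow> Q \<subseteq> T"
  by (auto simp: candidates_def subjects_def)

lemma finite_candidates: "finite Q \<Longrightarrow> finite (candidates Q T)"
  by (simp add: candidates_def finite_subjects)

lemma initial_state_eq_candidates:
  assumes "vocabulary Uso Up L Var" and "is_query Uso Up L Var Q"
  shows "initial_state L Q = ({}, {}, candidates Q {})"
proof -
  have "subjects Q \<inter> L = {}"
    using assms unfolding vocabulary_def is_query_def subjects_def by blast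
  then show ?thesis
    by (auto simp: initial_state_def candidates_def nodes_def)
qed

text \<open>The description by \<open>candidates\<close> survives an iteration, whatever
  \<open>ext\<close> is: \<open>ext\<close> changes only the output, and successive removals of
  covered triples from a star collapse into one.\<close>

lemma iteration_candidates:
  assumes "selection_rule sel" and "finite Q" and "candidates Q T \<noteq> {}"
  obtains n where "n \<in> subjects (Q - T)"
    and "iteration sel ext (R, T, candidates Q T) =
      (insert (ext n (star Q n - T)) R, T \<union> star Q n, candidates Q (T \<union> star Q n))"
proof -
  have "sel (R, T, candidates Q T) \<in> candidates Q T"
    using assms finite_candidates[of Q T] by (auto simp: selection_rule_def is_arg_max_def)
  then obtain n where n: "n \<in> subjects (Q - T)" "sel (R, T, candidates Q T) = (n, star Q n - T)"
    by (auto simp: candidates_def)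
  let ?T' = "T \<union> (star Q n - T)"
  have "{(m, Sm - ?T') | m Sm. (m, Sm) \<in> candidates Q T - {(n, star Q n - T)} \<and>
      m \<in> subjects (Sm - ?T')} = candidates Q ?T'"
    (is "?S = _")
  proof (intro set_eqI iffI)
    fix x
    assume "x \<in> ?S"
    then obtain m where "x = (m, star Q m - T - ?T')" "m \<in> subjects (star Q m - T - ?T')"
      by (auto simp: candidates_def)
    moreover have "star Q m - T - ?T' = star Q m - ?T'"
      by blast
    ultimately show "x \<in> candidates Q ?T'"
      by (simp add: candidates_def subjects_star_Diff)
  next
    fix x
    assume "x \<in> candidates Q ?T'"
    then obtain m where m: "x = (m, star Q m - ?T')" "m \<in> subjects (Q - ?T')"
      by (auto simp: candidates_def)
    have eq: "star Q m - T - ?T' = star Q m - ?T'"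
      by blast
    \<comment> \<open>The explicit deletion of the selected pair agrees with
      \<open>candidates\<close>: once its star is covered, \<open>n\<close> is the subject of no
      uncovered triple.\<close>
    have "m \<noteq> n"
      using m(2) not_subject_if_star_covered[of n Q T] by blast
    moreover have "m \<in> subjects (Q - T)"
      using m(2) by (auto simp: subjects_def)
    ultimately have "(m, star Q m - T) \<in> candidates Q T - {(n, star Q n - T)}"
      by (simp add: candidates_def)
    moreover have "m \<in> subjects (star Q m - T - ?T')"
      unfolding eq subjects_star_Diff by (rule m(2))
    moreover have "x = (m, star Q m - T - ?T')"
      unfolding eq by (rule m(1))
    ultimately show "x \<in> ?S"
      by blast
  qed
  then have "iteration sel ext (R, T, candidates Q T) =
      (insert (ext n (star Q n - T)) R, ?T', candidates Q ?T')"
    by (simp add: iteration_def n(2) Let_def)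
  then show thesis
    using that[OF n(1)] by (simp only: Un_Diff_cancel)
qed

text \<open>The centre is \<open>n\<close>. The inclusion makes every triple incident to
  \<open>n\<close>; the membership gives both non-emptiness and a triple leaving
  \<open>n\<close>.\<close>

lemma is_so_query_if_subset_star:
  assumes "is_query Uso Up L Var Q" and "P \<subseteq> star Q n" and "n \<in> subjects P"
  shows "is_so_query Uso Up L Var P"
proof -
  have "P \<subseteq> Q" "P \<noteq> {}"
    using assms(2,3) by (auto simp: star_def subjects_def)
  then have "is_query Uso Up L Var P"
    using assms(1) finite_subset[of P Q] by (auto simp: is_query_def)
  moreover have "\<forall>(s, p, ob) \<in> P. s = n \<or> ob = n"
    using assms(2) by (auto simp: star_def)
  ultimately show ?thesis
    using assms(3) by (auto simp: is_so_query_def nodes_def)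
qed

text \<open>Treats both algorithms at once. The lower bound on \<open>ext\<close> secures coverage
  and a triple with the centre as subject; the upper bound keeps all triples incident to the
  centre.\<close>

lemma run_so_decomposition:
  assumes voc: "vocabulary Uso Up L Var"
    and query: "is_query Uso Up L Var Q"
    and sel: "selection_rule sel"
    and ext_lower: "\<And>n Q'. Q' \<subseteq> ext n Q'"
    and ext_upper: "\<And>n Q'. Q' \<subseteq> star Q n \<Longrightarrow> ext n Q' \<subseteq> star Q n"
  shows "\<exists>R. run sel ext L Q = Some R \<and> is_decomposition Q R \<and>
    (\<forall>Q' \<in> R. is_so_query Uso Up L Var Q')"
proof -
  \<comment> \<open>At the end \<open>Q \<subseteq> T\<close>, so
    \<open>T \<subseteq> \<Union>R\<close> and \<open>P \<subseteq> Q\<close> for all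
    \<open>P \<in> R\<close> force \<open>\<Union>R = Q\<close>.\<close>
  define I where "I = (\<lambda>(R, T, S). S = candidates Q T \<and> T \<subseteq> \<Union>R \<and> finite R \<and>
    (\<forall>P \<in> R. P \<subseteq> Q \<and> is_so_query Uso Up L Var P))"
  have fin: "finite Q"
    using query by (simp add: is_query_def)
  \<comment> \<open>\<open>fst (snd st)\<close> is the set \<open>T\<close> of the state, so the
    measure counts uncovered triples.\<close>
  have step: "I (iteration sel ext st) \<and>
      card (Q - fst (snd (iteration sel ext st))) < card (Q - fst (snd st))"
    if "I st" "case st of (R, T, S) \<Rightarrow> S \<noteq> {}" for st
  proof -
    obtain R T S where RTS: "st = (R, T, S)"
      by (rule prod_cases3)
    then have st: "st = (R, T, candidates Q T)" and ne: "candidates Q T \<noteq> {}"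
      and TR: "T \<subseteq> \<Union>R" and R: "finite R" "\<forall>P \<in> R. P \<subseteq> Q \<and> is_so_query Uso Up L Var P"
      using that by (simp_all add: I_def)
    obtain n where n: "n \<in> subjects (Q - T)"
      and it: "iteration sel ext st =
        (insert (ext n (star Q n - T)) R, T \<union> star Q n, candidates Q (T \<union> star Q n))"
      unfolding st using iteration_candidates[OF sel fin ne] by metis
    have lower: "star Q n - T \<subseteq> ext n (star Q n - T)"
      by (rule ext_lower)
    have upper: "ext n (star Q n - T) \<subseteq> star Q n"
      by (rule ext_upper) blast
    have "n \<in> subjects (ext n (star Q n - T))"
      using subjects_star_Diff[THEN iffD2, OF n] lower by (auto simp: subjects_def)
    then have "is_so_query Uso Up L Var (ext n (star Q n - T))"
      by (rule is_so_query_if_subset_star[OF query upper])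
    moreover have "star Q n \<subseteq> Q"
      by (auto simp: star_def)
    \<comment> \<open>A triple of \<open>star Q n\<close> lies in \<open>T\<close>, covered by
      \<open>R\<close>, or in \<open>star Q n - T\<close>, covered by the new subquery.\<close>
    ultimately have "I (iteration sel ext st)"
      using lower upper TR R by (auto simp: it I_def)
    \<comment> \<open>Strict because an uncovered triple with subject \<open>n\<close> lies in
      \<open>star Q n\<close>.\<close>
    moreover have "Q - (T \<union> star Q n) \<subset> Q - T"
      using n by (auto simp: subjects_def star_def)
    then have "card (Q - (T \<union> star Q n)) < card (Q - T)"
      using fin by (intro psubset_card_mono) simp_all
    ultimately show ?thesis
      by (simp add: it) (simp add: st)
  qed
  have init: "I (initial_state L Q)"
    by (simp add: I_def initial_state_eq_candidates[OF voc query])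
  obtain st where st:
    "while_option (\<lambda>(R, T, S). S \<noteq> {}) (iteration sel ext) (initial_state L Q) = Some st"
    using measure_while_option_Some[where P = I and f = "\<lambda>st. card (Q - fst (snd st))", OF step init]
    by blast
  obtain R T S where RTS: "st = (R, T, S)"
    by (rule prod_cases3)
  have "I st"
    using while_option_rule[where P = I, OF _ st init] step by blast
  moreover have "\<not> (case st of (R, T, S) \<Rightarrow> S \<noteq> {})"
    using while_option_stop[OF st] .
  ultimately have "Q \<subseteq> T" "T \<subseteq> \<Union>R" "finite R"
    and so: "\<forall>P \<in> R. P \<subseteq> Q \<and> is_so_query Uso Up L Var P"
    by (simp_all add: RTS I_def candidates_eq_empty_iff)
  moreover have "\<Union>R = Q"
    using calculation by blast
  moreover have "\<forall>P \<in> R. P \<noteq> {}"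
    using so by (simp add: is_so_query_def is_query_def)
  ultimately have "is_decomposition Q R"
    by (simp add: is_decomposition_def)
  then show ?thesis
    using so by (simp add: run_def st RTS)
qed

theorem proposition13:
  fixes Uso Up L Var :: "'a set"
    and Q :: "'a triple set"
    and sel :: "'a state \<Rightarrow> 'a \<times> 'a triple set"
  assumes "vocabulary Uso Up L Var"
    and "is_query Uso Up L Var Q"
    and "selection_rule sel"
  shows "(\<exists>R. max_degree sel L Q = Some R \<and>
            is_decomposition Q R \<and> (\<forall>Q' \<in> R. is_so_query Uso Up L Var Q'))
       \<and> (\<exists>R. max_degree_with_redundancy sel L Var Q = Some R \<and>
            is_decomposition Q R \<and> (\<forall>Q' \<in> R. is_so_query Uso Up L Var Q'))"
proof
  show "\<exists>R. max_degree sel L Q = Some R \<and>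
      is_decomposition Q R \<and> (\<forall>Q' \<in> R. is_so_query Uso Up L Var Q')"
    unfolding max_degree_def using assms by (rule run_so_decomposition) auto
  \<comment> \<open>The triples added by \<open>redundant_extension\<close> belong to
    \<open>Q\<close> and have \<open>n\<close> as an endpoint, so they stay inside
    \<open>star Q n\<close>.\<close>
  show "\<exists>R. max_degree_with_redundancy sel L Var Q = Some R \<and>
      is_decomposition Q R \<and> (\<forall>Q' \<in> R. is_so_query Uso Up L Var Q')"
    unfolding max_degree_with_redundancy_def using assms
    by (rule run_so_decomposition) (auto simp: redundant_extension_def star_def)
qed

end
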